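(* Let $k\ge2$ and $N\ge1$ be integers, let $p_0,\dots,p_N$ be real numbers, and set $p_n:=0$ for $n\notin\{0,\dots,N\}$. Let $q:=\left\lceil\frac N{k-1}\right\rceil-1$ and, for $0\le i\le k-1$, let $M_i$ be the $(q+1)\times(q+1)$ matrix whose $(j+1,j'+1)$ entry is $p_{kj+i-j'}$ for $0\le j,j'\le q$. Let $F:\mathbb R\to\mathbb R$ be a solution of $$F(x)=\sum_{n=0}^Np_nF(kx-n)\quad\text{for all }x\in\mathbb R$$ which is constant on $(-\infty,0)$ and constant on $[q+1,+\infty)$, and for $x\in[0,1)$ let $$\phi_F(x):=\begin{pmatrix} F(x) \\ F(x+1) \\ \vdots \\ F(x+q) \end{pmatrix}.$$ Then, for every $0\le i\le k-1$ and all $x,y$ in the same interval $\big[\frac ik,\frac{i+1}k\big)$, $$\phi_F(x)-\phi_F(y)=M_i\big(\phi_F(kx-i)-\phi_F(ky-i)\big).$$ *)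

theory Defs
  imports Complex_Main "Jordan_Normal_Form.Matrix"
begin

(* For k >= 2 and N >= 1 the ceiling is at least 1, so the conversion to nat does not truncate. *)
definition refine_q :: "nat \<Rightarrow> nat \<Rightarrow> nat" where
  "refine_q k N = nat (\<lceil>real N / (real k - 1)\<rceil> - 1)"

(* Entries are indexed from 0, and p is indexed by int because k * j + i - j' may be negative. *)
definition refine_mat :: "nat \<Rightarrow> nat \<Rightarrow> (int \<Rightarrow> real) \<Rightarrow> nat \<Rightarrow> real mat" where
  "refine_mat k N p i =
     mat (refine_q k N + 1) (refine_q k N + 1)
       (\<lambda>(j, j'). p (int k * int j + int i - int j'))"

definition refine_vec :: "nat \<Rightarrow> nat \<Rightarrow> (real \<Rightarrow> real) \<Rightarrow> real \<Rightarrow> real vec" where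
  "refine_vec k N F x = vec (refine_q k N + 1) (\<lambda>j. F (x + real j))"

end

theory Submission
  imports Defs
begin

text \<open>
  Put \<open>u = k x - i\<close> and \<open>v = k y - i\<close>, both in \<open>[0, 1)\<close>. Subtracting the functional equations at
  \<open>x + j\<close> and \<open>y + j\<close> gives a sum of terms \<open>p\<^sub>n (F (u + m) - F (v + m))\<close> with \<open>m = k j + i - n\<close>.
  If \<open>m < 0\<close> or \<open>m > q\<close>, then \<open>u + m\<close> and \<open>v + m\<close> lie in the same region of constancy of \<open>F\<close>, so only
  \<open>0 \<le> m \<le> q\<close> contributes.
\<close>

theorem proposition3p5:
  fixes k N :: nat and p :: "int \<Rightarrow> real" and F :: "real \<Rightarrow> real"
  assumes "k \<ge> 2" and "N \<ge> 1"
    and "\<And>n. n \<notin> {0..int N} \<Longrightarrow> p n = 0"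
    and "\<And>x. F x = (\<Sum>n = 0..int N. p n * F (real k * x - real_of_int n))"
    and "\<exists>c. \<forall>x \<in> {..<0}. F x = c"
    and "\<exists>c. \<forall>x \<in> {real (refine_q k N) + 1..}. F x = c"
  shows "\<forall>i \<in> {0..k - 1}. \<forall>x \<in> {real i / real k..<(real i + 1) / real k}.
           \<forall>y \<in> {real i / real k..<(real i + 1) / real k}.
             refine_vec k N F x - refine_vec k N F y =
             refine_mat k N p i *\<^sub>v
               (refine_vec k N F (real k * x - real i) - refine_vec k N F (real k * y - real i))"
proof (intro ballI)
  define q where "q = refine_q k N"
  fix i x y
  assume x: "x \<in> {real i / real k..<(real i + 1) / real k}"
    and y: "y \<in> {real i / real k..<(real i + 1) / real k}"
  define u v where "u = real k * x - real i" and "v = real k * y - real i"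
  have u: "0 \<le> u" "u < 1" and v: "0 \<le> v" "v < 1"
    using x y \<open>k \<ge> 2\<close> by (auto simp: u_def v_def field_simps)
  define D where "D m = F (u + of_int m) - F (v + of_int m)" for m :: int
  have D0: "D m = 0" if "m \<notin> {0..int q}" for m
  proof (cases "m < 0")
    case True
    \<comment> \<open>Integrality gives \<open>m \<le> -1\<close>, which with
      \<open>u, v < 1\<close> puts both points strictly below 0.\<close>
    then have "real_of_int m \<le> -1" by linarith
    with u v have "u + of_int m \<in> {..<0}" "v + of_int m \<in> {..<0}" by auto
    with assms(5) show ?thesis unfolding D_def by force
  next
    case False
    with that have "real_of_int m \<ge> real q + 1" by simp
    with u v have "u + of_int m \<in> {real q + 1..}" "v + of_int m \<in> {real q + 1..}" by auto
    with assms(6) show ?thesis unfolding D_def q_def by force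
  qed
  have row: "F (x + real j) - F (y + real j) =
      (\<Sum>l = 0..<q + 1. p (int k * int j + int i - int l) * D (int l))" for j
  proof -
    define c where "c = int k * int j + int i"
    \<comment> \<open>The arguments match because \<open>k * (x + j) - n = u + (c - n)\<close>, and
      likewise for \<open>y\<close> and \<open>v\<close>.\<close>
    have "F (x + real j) - F (y + real j) = (\<Sum>n = 0..int N. p n * D (c - n))"
      by (subst (1 2) assms(4))
        (simp add: D_def u_def v_def c_def sum_subtractf [symmetric] algebra_simps)
    \<comment> \<open>Neither index range need contain the other: terms only on the left vanish by
      \<open>D0\<close>, terms only on the right because \<open>p n = 0\<close> there.\<close>
    also have "\<dots> = (\<Sum>n = c - int q..c. p n * D (c - n))"
      by (rule sum.mono_neutral_cong) (use D0 assms(3) in auto)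
    also have "\<dots> = (\<Sum>l = 0..<q + 1. p (c - int l) * D (int l))"
      by (rule sum.reindex_bij_witness [where i = "\<lambda>l. c - int l" and j = "\<lambda>n. nat (c - n)"]) auto
    finally show ?thesis by (simp add: c_def)
  qed
  show "refine_vec k N F x - refine_vec k N F y =
      refine_mat k N p i *\<^sub>v
        (refine_vec k N F (real k * x - real i) - refine_vec k N F (real k * y - real i))"
    using row
    by (intro eq_vecI)
      (simp_all add: refine_vec_def refine_mat_def scalar_prod_def D_def u_def v_def q_def)
qed

end
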